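(* Let $\mathcal{Q}=(Q,\preceq,I,\circ)$ be a quantale. A $\mathcal{Q}$-category is skeletal and complete if and only if it is injective with respect to fully faithful $\mathcal{Q}$-functors.
   Context: A (unital, not necessarily commutative) quantale $\mathcal{Q}=(Q,\preceq,I,\circ)$ is a complete lattice $(Q,\preceq)$ with a monoid structure $(Q,I,\circ)$ such that $\circ$ preserves arbitrary suprema in each variable. The residuations $\swarrow$ and $\searrow$ are defined by $y\preceq z\swarrow x \iff y\circ x\preceq z \iff x\preceq y\searrow z$. A $\mathcal{Q}$-category $\mathcal{C}$ consists of a set $\mathrm{ob}(\mathcal{C})$ (one writes $c\in\mathcal{C}$ for $c\in\mathrm{ob}(\mathcal{C})$) and elements $\mathcal{C}(c,c')\in Q$ for $c,c'\in\mathcal{C}$ such that $I\preceq\mathcal{C}(c,c)$ and $\mathcal{C}(c',c'')\circ\mathcal{C}(c,c')\preceq\mathcal{C}(c,c'')$ for all $c,c',c''$. A $\mathcal{Q}$-functor $f\colon\mathcal{C}\to\mathcal{D}$ is a function $\mathrm{ob}(\mathcal{C})\to\mathrm{ob}(\mathcal{D})$ with $\mathcal{C}(c,c')\preceq\mathcal{D}(f(c),f(c'))$ for all $c,c'$; it is fully faithful if equality always holds. Define a preorder on $\mathrm{ob}(\mathcal{C})$ by $c\preceq_{\mathcal{C}}c'\iff I\preceq\mathcal{C}(c,c')$. Objects $c,c'$ are isomorphic if $c\preceq_{\mathcal{C}}c'$ and $c'\preceq_{\mathcal{C}}c$; $\mathcal{C}$ is skeletal if isomorphic objects are equal. A power of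 $c\in\mathcal{C}$ by $x\in Q$ is an object $c'\in\mathcal{C}$ with $\mathcal{C}(d,c')=x\searrow\mathcal{C}(d,c)$ for all $d\in\mathcal{C}$; a copower of $c$ by $x$ is an object $c'\in\mathcal{C}$ with $\mathcal{C}(c',d)=\mathcal{C}(c,d)\swarrow x$ for all $d\in\mathcal{C}$. $\mathcal{C}$ is complete if all powers and all copowers (for all $c\in\mathcal{C}$, $x\in Q$) exist in $\mathcal{C}$ and $\mathcal{C}$ is order-complete, i.e. the poset reflection (quotient by isomorphism) of $(\mathrm{ob}(\mathcal{C}),\preceq_{\mathcal{C}})$ is a complete lattice. A $\mathcal{Q}$-category $\mathcal{E}$ is injective (with respect to fully faithful $\mathcal{Q}$-functors) if for all $\mathcal{Q}$-categories $\mathcal{C},\mathcal{D}$, every $\mathcal{Q}$-functor $f\colon\mathcal{C}\to\mathcal{E}$ and every fully faithful $\mathcal{Q}$-functor $i\colon\mathcal{C}\to\mathcal{D}$, there is a (not necessarily unique) $\mathcal{Q}$-functor $g\colon\mathcal{D}\to\mathcal{E}$ with $f=g\circ i$. *)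

theory Defs
  imports "HOL-Algebra.Complete_Lattice"
begin

text \<open>The underlying set of a quantale is a type \<open>'q\<close>; the unit \<open>I\<close> is \<open>1\<close> and the composition
  is \<open>*\<close>.\<close>

class quantale = Complete_Lattices.complete_lattice + monoid_mult +
  assumes Sup_mult_distrib: "Sup A * y = Sup ((\<lambda>x. x * y) ` A)"
    and mult_Sup_distrib: "y * Sup A = Sup ((\<lambda>x. y * x) ` A)"
begin

definition swarrow :: "'a \<Rightarrow> 'a \<Rightarrow> 'a" (infix "\<swarrow>" 65)
  where "z \<swarrow> x = Sup {y. y * x \<le> z}"

definition searrow :: "'a \<Rightarrow> 'a \<Rightarrow> 'a" (infix "\<searrow>" 65)
  where "y \<searrow> z = Sup {x. y * x \<le> z}"

lemma mult_mono_right: "x \<le> y \<Longrightarrow> x * z \<le> y * z"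
  using Sup_mult_distrib[of "{x, y}" z] by (simp add: sup.absorb2 le_iff_sup)

lemma mult_mono_left: "x \<le> y \<Longrightarrow> z * x \<le> z * y"
  using mult_Sup_distrib[of z "{x, y}"] by (simp add: sup.absorb2 le_iff_sup)

lemma swarrow_iff: "y \<le> z \<swarrow> x \<longleftrightarrow> y * x \<le> z"
proof
  assume "y \<le> z \<swarrow> x"
  then have "y * x \<le> (z \<swarrow> x) * x" by (rule mult_mono_right)
  also have "\<dots> \<le> z"
    unfolding swarrow_def Sup_mult_distrib by (rule Sup_least) auto
  finally show "y * x \<le> z" .
qed (auto simp: swarrow_def intro: Sup_upper)

lemma searrow_iff: "x \<le> y \<searrow> z \<longleftrightarrow> y * x \<le> z"
proof
  assume "x \<le> y \<searrow> z"
  then have "y * x \<le> y * (y \<searrow> z)" by (rule mult_mono_left)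
  also have "\<dots> \<le> z"
    unfolding searrow_def mult_Sup_distrib by (rule Sup_least) auto
  finally show "y * x \<le> z" .
qed (auto simp: searrow_def intro: Sup_upper)

end

record ('c, 'q) qcat =
  ob :: "'c set"
  hom :: "'c \<Rightarrow> 'c \<Rightarrow> 'q"

definition qcategory :: "('c, 'q::quantale) qcat \<Rightarrow> bool"
  where "qcategory C \<longleftrightarrow>
    (\<forall>c\<in>ob C. 1 \<le> hom C c c) \<and>
    (\<forall>c\<in>ob C. \<forall>c'\<in>ob C. \<forall>c''\<in>ob C. hom C c' c'' * hom C c c' \<le> hom C c c'')"

definition qfunctor :: "('c, 'q::quantale) qcat \<Rightarrow> ('d, 'q) qcat \<Rightarrow> ('c \<Rightarrow> 'd) \<Rightarrow> bool"
  where "qfunctor C D f \<longleftrightarrow>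
    f ` ob C \<subseteq> ob D \<and> (\<forall>c\<in>ob C. \<forall>c'\<in>ob C. hom C c c' \<le> hom D (f c) (f c'))"

definition fully_faithful :: "('c, 'q::quantale) qcat \<Rightarrow> ('d, 'q) qcat \<Rightarrow> ('c \<Rightarrow> 'd) \<Rightarrow> bool"
  where "fully_faithful C D f \<longleftrightarrow>
    qfunctor C D f \<and> (\<forall>c\<in>ob C. \<forall>c'\<in>ob C. hom C c c' = hom D (f c) (f c'))"

definition ob_le :: "('c, 'q::quantale) qcat \<Rightarrow> 'c \<Rightarrow> 'c \<Rightarrow> bool"
  where "ob_le C c c' \<longleftrightarrow> 1 \<le> hom C c c'"

definition isomorphic :: "('c, 'q::quantale) qcat \<Rightarrow> 'c \<Rightarrow> 'c \<Rightarrow> bool"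
  where "isomorphic C c c' \<longleftrightarrow> ob_le C c c' \<and> ob_le C c' c"

definition skeletal :: "('c, 'q::quantale) qcat \<Rightarrow> bool"
  where "skeletal C \<longleftrightarrow> (\<forall>c\<in>ob C. \<forall>c'\<in>ob C. isomorphic C c c' \<longrightarrow> c = c')"

definition is_power :: "('c, 'q::quantale) qcat \<Rightarrow> 'c \<Rightarrow> 'q \<Rightarrow> 'c \<Rightarrow> bool"
  where "is_power C c x c' \<longleftrightarrow> c' \<in> ob C \<and> (\<forall>d\<in>ob C. hom C d c' = x \<searrow> hom C d c)"

definition is_copower :: "('c, 'q::quantale) qcat \<Rightarrow> 'c \<Rightarrow> 'q \<Rightarrow> 'c \<Rightarrow> bool"
  where "is_copower C c x c' \<longleftrightarrow> c' \<in> ob C \<and> (\<forall>d\<in>ob C. hom C c' d = hom C c d \<swarrow> x)"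

definition iso_rel :: "('c, 'q::quantale) qcat \<Rightarrow> ('c \<times> 'c) set"
  where "iso_rel C = {(c, c'). c \<in> ob C \<and> c' \<in> ob C \<and> isomorphic C c c'}"

definition poset_reflection :: "('c, 'q::quantale) qcat \<Rightarrow> 'c set gorder"
  where "poset_reflection C =
    \<lparr>carrier = ob C // iso_rel C, eq = (=), le = (\<lambda>A B. \<exists>a\<in>A. \<exists>b\<in>B. ob_le C a b)\<rparr>"

definition order_complete :: "('c, 'q::quantale) qcat \<Rightarrow> bool"
  where "order_complete C \<longleftrightarrow> Complete_Lattice.complete_lattice (poset_reflection C)"

definition qcomplete :: "('c, 'q::quantale) qcat \<Rightarrow> bool"
  where "qcomplete C \<longleftrightarrow>
    (\<forall>c\<in>ob C. \<forall>x. \<exists>c'. is_power C c x c') \<and>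
    (\<forall>c\<in>ob C. \<forall>x. \<exists>c'. is_copower C c x c') \<and>
    order_complete C"

text \<open>A formula of HOL cannot quantify over types, so the types from which the objects of the test
  categories \<open>C\<close> and \<open>D\<close> are drawn are parameters. Their object sets range over all subsets of these
  types, including the empty one. A fully faithful functor need not be injective on objects.\<close>

definition qinjective :: "'c itself \<Rightarrow> 'd itself \<Rightarrow> ('e, 'q::quantale) qcat \<Rightarrow> bool"
  where "qinjective _ _ E \<longleftrightarrow>
    (\<forall>(C :: ('c, 'q) qcat) (D :: ('d, 'q) qcat) f i.
      qcategory C \<and> qcategory D \<and> qfunctor C E f \<and> fully_faithful C D i \<longrightarrow>
      (\<exists>g. qfunctor D E g \<and> (\<forall>c\<in>ob C. f c = g (i c))))"

end

theory Submission
  imports Defs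
begin

text \<open>The Yoneda map embeds \<open>E\<close> fully faithfully into the \<open>Q\<close>-category of all functions
  \<open>ob E \<Rightarrow> Q\<close>. If \<open>E\<close> is injective, this embedding has a retraction, and the retraction sends the
  functions \<open>a \<mapsto> x * E(a, c)\<close>, \<open>a \<mapsto> x \<searrow> E(a, c)\<close> and \<open>a \<mapsto> \<Squnion>\<^sub>s E(a, s)\<close> to a copower, a power and a
  supremum in \<open>E\<close>; isomorphic objects have the same image under the embedding, hence are equal.
  Conversely, copowers and suprema yield weighted colimits (powers make the order-theoretic suprema
  enriched colimits), so functors extend along fully faithful functors by left Kan extension.\<close>

section \<open>Homs and the underlying preorder of a Q-category\<close>

lemma qcategory_id: "qcategory C \<Longrightarrow> c \<in> ob C \<Longrightarrow> 1 \<le> hom C c c"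
  by (simp add: qcategory_def)

lemma qcategory_comp:
  "qcategory C \<Longrightarrow> a \<in> ob C \<Longrightarrow> b \<in> ob C \<Longrightarrow> c \<in> ob C \<Longrightarrow> hom C b c * hom C a b \<le> hom C a c"
  by (simp add: qcategory_def)

lemma quantale_mult_mono: "a \<le> b \<Longrightarrow> c \<le> d \<Longrightarrow> a * c \<le> b * (d::'q::quantale)"
  by (meson mult_mono_left mult_mono_right order_trans)

lemma qcategory_comp_le:
  assumes "qcategory C" "a \<in> ob C" "b \<in> ob C" "c \<in> ob C" "y \<le> hom C b c" "x \<le> hom C a b"
  shows "y * x \<le> hom C a c"
  using quantale_mult_mono[OF assms(5,6)] qcategory_comp[OF assms(1-4)] by (rule order_trans)

lemma ob_le_refl: "qcategory C \<Longrightarrow> c \<in> ob C \<Longrightarrow> ob_le C c c"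
  by (simp add: ob_le_def qcategory_id)

lemma ob_le_trans:
  assumes "qcategory C" "a \<in> ob C" "b \<in> ob C" "c \<in> ob C" "ob_le C a b" "ob_le C b c"
  shows "ob_le C a c"
  using qcategory_comp_le[OF assms(1-4), of 1 1] assms(5,6) by (simp add: ob_le_def)

lemma hom_mono_right:
  assumes "qcategory C" "a \<in> ob C" "b \<in> ob C" "c \<in> ob C" "ob_le C b c"
  shows "hom C a b \<le> hom C a c"
  using qcategory_comp_le[OF assms(1-4), of 1 "hom C a b"] assms(5) by (simp add: ob_le_def)

lemma hom_antimono_left:
  assumes "qcategory C" "a \<in> ob C" "b \<in> ob C" "c \<in> ob C" "ob_le C a b"
  shows "hom C b c \<le> hom C a c"
  using qcategory_comp_le[OF assms(1-4), of "hom C b c" 1] assms(5) by (simp add: ob_le_def)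

section \<open>Order-completeness in terms of suprema of sets of objects\<close>

definition is_lub :: "('c, 'q::quantale) qcat \<Rightarrow> 'c set \<Rightarrow> 'c \<Rightarrow> bool"
  where "is_lub C S s \<longleftrightarrow>
    s \<in> ob C \<and> (\<forall>u\<in>ob C. ob_le C s u \<longleftrightarrow> (\<forall>a\<in>S. ob_le C a u))"

lemma equiv_iso_rel: "qcategory C \<Longrightarrow> equiv (ob C) (iso_rel C)"
  by (rule equivI)
    (auto simp: iso_rel_def isomorphic_def refl_on_def sym_def trans_def
      intro: ob_le_refl dest: ob_le_trans)

text \<open>The order on classes asks only for some pair of comparable representatives; composing
  with the isomorphisms to \<open>a\<close> and \<open>b\<close> transfers the comparison to
  these.\<close>

lemma reflection_class_le_iff:
  assumes C: "qcategory C" and a: "a \<in> ob C" and b: "b \<in> ob C"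
  shows "iso_rel C `` {a} \<sqsubseteq>\<^bsub>poset_reflection C\<^esub> iso_rel C `` {b} \<longleftrightarrow> ob_le C a b"
proof
  assume "iso_rel C `` {a} \<sqsubseteq>\<^bsub>poset_reflection C\<^esub> iso_rel C `` {b}"
  then obtain a' b' where "(a, a') \<in> iso_rel C" "(b, b') \<in> iso_rel C" "ob_le C a' b'"
    by (auto simp: poset_reflection_def)
  then show "ob_le C a b"
    using ob_le_trans[OF C a, of a' b'] ob_le_trans[OF C a, of b' b] b
    by (auto simp: iso_rel_def isomorphic_def)
next
  assume "ob_le C a b"
  then show "iso_rel C `` {a} \<sqsubseteq>\<^bsub>poset_reflection C\<^esub> iso_rel C `` {b}"
    using a b ob_le_refl[OF C] by (auto simp: poset_reflection_def iso_rel_def isomorphic_def)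
qed

lemma carrier_reflection:
  "carrier (poset_reflection C) = (\<lambda>c. iso_rel C `` {c}) ` ob C"
  by (auto simp: poset_reflection_def quotient_def)

lemma partial_order_reflection:
  assumes C: "qcategory C"
  shows "partial_order (poset_reflection C)"
proof -
  let ?L = "poset_reflection C"
  have eq: "(.=\<^bsub>?L\<^esub>) = (=)" by (simp add: poset_reflection_def)
  have antisym: "x = y"
    if le: "x \<sqsubseteq>\<^bsub>?L\<^esub> y" "y \<sqsubseteq>\<^bsub>?L\<^esub> x"
      and carrier: "x \<in> carrier ?L" "y \<in> carrier ?L" for x y
  proof -
    obtain a b where ab: "a \<in> ob C" "b \<in> ob C" "x = iso_rel C `` {a}" "y = iso_rel C `` {b}"
      using carrier by (auto simp: carrier_reflection)
    then have "ob_le C a b" "ob_le C b a"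
      using le by (simp_all add: reflection_class_le_iff[OF C])
    then have "(a, b) \<in> iso_rel C" using ab by (simp add: iso_rel_def isomorphic_def)
    then show ?thesis using equiv_class_eq[OF equiv_iso_rel[OF C]] ab by simp
  qed
  show ?thesis
  proof
    show "x \<sqsubseteq>\<^bsub>?L\<^esub> x" if "x \<in> carrier ?L" for x
      using that by (auto simp: carrier_reflection reflection_class_le_iff[OF C] ob_le_refl[OF C])
    show "x \<sqsubseteq>\<^bsub>?L\<^esub> z"
      if "x \<sqsubseteq>\<^bsub>?L\<^esub> y" "y \<sqsubseteq>\<^bsub>?L\<^esub> z" "x \<in> carrier ?L" "y \<in> carrier ?L" "z \<in> carrier ?L" for x y z
      using that
      by (auto simp: carrier_reflection reflection_class_le_iff[OF C] dest: ob_le_trans[OF C])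
  qed (use antisym in \<open>auto simp: eq\<close>)
qed

text \<open>Every element of the reflection is the class of an object and classes are compared
  through representatives, so upper bounds in the quotient are exactly the classes of upper bounds
  in \<open>C\<close>.\<close>

lemma least_reflection_iff:
  assumes C: "qcategory C" and s: "s \<in> ob C" and S: "S \<subseteq> ob C"
  shows "least (poset_reflection C) (iso_rel C `` {s})
      (Upper (poset_reflection C) ((\<lambda>c. iso_rel C `` {c}) ` S)) \<longleftrightarrow> is_lub C S s"
proof -
  let ?L = "poset_reflection C" and ?q = "\<lambda>c. iso_rel C `` {c}"
  have mem: "?q u \<in> Upper ?L (?q ` S) \<longleftrightarrow> (\<forall>a\<in>S. ob_le C a u)" if u: "u \<in> ob C" for u
  proof -
    have "?q ` S \<subseteq> carrier ?L" "?q u \<in> carrier ?L"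
      using S u by (auto simp: carrier_reflection)
    then have "?q u \<in> Upper ?L (?q ` S) \<longleftrightarrow> (\<forall>a\<in>S. ?q a \<sqsubseteq>\<^bsub>?L\<^esub> ?q u)"
      unfolding Upper_def by blast
    then show ?thesis using S u by (simp add: reflection_class_le_iff[OF C] subset_iff)
  qed
  have sub: "Upper ?L (?q ` S) \<subseteq> carrier ?L" unfolding Upper_def by (rule Int_lower2)
  show ?thesis
  proof
    assume l: "least ?L (?q s) (Upper ?L (?q ` S))"
    then have upper: "\<forall>a\<in>S. ob_le C a s" by (simp add: least_def mem s)
    have "ob_le C s u" if "u \<in> ob C" "\<forall>a\<in>S. ob_le C a u" for u
      using l mem[OF that(1)] that reflection_class_le_iff[OF C s that(1)]
      by (simp add: least_def)
    moreover have "ob_le C a u" if "u \<in> ob C" "ob_le C s u" "a \<in> S" for a u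
      using that upper S ob_le_trans[OF C _ s that(1), of a] by blast
    ultimately show "is_lub C S s"
      unfolding is_lub_def using s by (intro conjI ballI iffI) assumption+
  next
    assume l: "is_lub C S s"
    \<comment> \<open>The instance \<open>u = s\<close> of \<open>is_lub\<close> with reflexivity
      makes \<open>s\<close> itself an upper bound.\<close>
    then have "?q s \<in> Upper ?L (?q ` S)"
      using ob_le_refl[OF C s] s by (simp add: mem is_lub_def)
    moreover have "?q s \<sqsubseteq>\<^bsub>?L\<^esub> x" if x: "x \<in> Upper ?L (?q ` S)" for x
    proof -
      have "x \<in> ?q ` ob C" using x sub carrier_reflection[of C] by (simp add: subset_iff)
      then obtain u where u: "u \<in> ob C" "x = ?q u" by (rule imageE)
      then show ?thesis
        using l x by (simp add: mem is_lub_def reflection_class_le_iff[OF C s])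
    qed
    ultimately show "least ?L (?q s) (Upper ?L (?q ` S))"
      unfolding least_def using sub by (intro conjI ballI) assumption+
  qed
qed

lemma order_complete_iff_lubs:
  assumes C: "qcategory C"
  shows "order_complete C \<longleftrightarrow> (\<forall>S\<subseteq>ob C. \<exists>s. is_lub C S s)"
proof
  let ?L = "poset_reflection C" and ?q = "\<lambda>c. iso_rel C `` {c}"
  assume "order_complete C"
  then interpret L: Complete_Lattice.complete_lattice ?L by (simp add: order_complete_def)
  show "\<forall>S\<subseteq>ob C. \<exists>s. is_lub C S s"
  proof (intro allI impI)
    fix S assume S: "S \<subseteq> ob C"
    then have "?q ` S \<subseteq> carrier ?L" by (auto simp: carrier_reflection)
    then obtain t where t: "least ?L t (Upper ?L (?q ` S))" using L.sup_exists by blast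
    then have "t \<in> carrier ?L" by (auto simp: least_def Upper_def)
    with t show "\<exists>s. is_lub C S s"
      using least_reflection_iff[OF C _ S] by (auto simp: carrier_reflection)
  qed
next
  let ?L = "poset_reflection C" and ?q = "\<lambda>c. iso_rel C `` {c}"
  assume lubs: "\<forall>S\<subseteq>ob C. \<exists>s. is_lub C S s"
  interpret partial_order ?L by (rule partial_order_reflection[OF C])
  have sup: "\<exists>t. least ?L t (Upper ?L A)" if A: "A \<subseteq> carrier ?L" for A
  proof -
    obtain S where S: "S \<subseteq> ob C" "A = ?q ` S"
      using A by (auto simp: carrier_reflection subset_image_iff)
    then obtain s where "is_lub C S s" using lubs by blast
    then show ?thesis using least_reflection_iff[OF C _ S(1)] S(2) by (auto simp: is_lub_def)
  qed
  have "\<exists>t. greatest ?L t (Lower ?L A)" if A: "A \<subseteq> carrier ?L" for A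
  proof -
    \<comment> \<open>An infimum of \<open>A\<close> is obtained as the supremum of its lower
      bounds.\<close>
    obtain t where t: "least ?L t (Upper ?L (Lower ?L A))" using sup[of "Lower ?L A"] by auto
    then have "t \<in> Lower ?L A"
      using A by (auto simp: least_def Upper_def Lower_def)
    then have "greatest ?L t (Lower ?L A)"
      using t by (auto simp: greatest_def least_def Upper_def Lower_def)
    then show ?thesis ..
  qed
  with sup show "order_complete C"
    unfolding order_complete_def by unfold_locales auto
qed

section \<open>Weighted colimits and left Kan extension\<close>

lemma lub_hom_eq_INF:
  assumes C: "qcategory C" and powers: "\<forall>c\<in>ob C. \<forall>x. \<exists>c'. is_power C c x c'"
    and S: "S \<subseteq> ob C" and s: "is_lub C S s" and e: "e \<in> ob C"
  shows "hom C s e = (INF a\<in>S. hom C a e)"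
proof (rule antisym)
  have s': "s \<in> ob C" "\<forall>a\<in>S. ob_le C a s"
    using s ob_le_refl[OF C] by (auto simp: is_lub_def)
  then show "hom C s e \<le> (INF a\<in>S. hom C a e)"
    using S by (auto intro!: INF_greatest hom_antimono_left[OF C _ _ e])
  let ?y = "INF a\<in>S. hom C a e"
  \<comment> \<open>\<open>is_lub\<close> tests \<open>s\<close> only through \<open>ob_le\<close>,
    that is, against the unit. The power of \<open>e\<close> by the candidate infimum turns
    \<open>?y \<le> hom C d e\<close> into \<open>ob_le C d p\<close>, where the supremum property
    applies.\<close>
  obtain p where p: "is_power C e ?y p" using powers e by blast
  have le_p: "ob_le C d p \<longleftrightarrow> ?y \<le> hom C d e" if "d \<in> ob C" for d
    using p that by (simp add: is_power_def ob_le_def searrow_iff)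
  have "ob_le C a p" if "a \<in> S" for a
    using that S le_p[of a] by (auto intro: INF_lower)
  then have "ob_le C s p" using s p by (auto simp: is_lub_def is_power_def)
  then show "?y \<le> hom C s e" using le_p s' by simp
qed

text \<open>The colimit of \<open>f\<close> weighted by \<open>w\<close> is the supremum of the
  copowers of \<open>f a\<close> by \<open>w a\<close>.\<close>

lemma weighted_colimit_exists:
  assumes C: "qcategory C" "qcomplete C" and f: "f ` A \<subseteq> ob C"
  shows "\<exists>v\<in>ob C. \<forall>e\<in>ob C. hom C v e = (INF a\<in>A. hom C (f a) e \<swarrow> w a)"
proof -
  have "\<forall>a\<in>A. \<exists>v. is_copower C (f a) (w a) v"
    using C(2) f by (auto simp: qcomplete_def)
  then obtain t where t: "\<forall>a\<in>A. is_copower C (f a) (w a) (t a)" by metis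
  then have tS: "t ` A \<subseteq> ob C" by (auto simp: is_copower_def)
  then obtain s where s: "is_lub C (t ` A) s"
    using C order_complete_iff_lubs[OF C(1)] by (auto simp: qcomplete_def)
  have "hom C s e = (INF a\<in>A. hom C (f a) e \<swarrow> w a)" if "e \<in> ob C" for e
    using lub_hom_eq_INF[OF C(1) _ tS s that] C(2) t that
    by (simp add: qcomplete_def is_copower_def image_comp)
  then show ?thesis using s by (auto simp: is_lub_def)
qed

lemma qinjective_if_skeletal_qcomplete:
  fixes E :: "('e, 'q::quantale) qcat"
  assumes E: "qcategory E" "skeletal E" "qcomplete E"
  shows "qinjective TYPE('c) TYPE('d) E"
  unfolding qinjective_def
proof (intro allI impI, elim conjE)
  fix C :: "('c, 'q) qcat" and D :: "('d, 'q) qcat" and f i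
  assume C: "qcategory C" and D: "qcategory D" and f: "qfunctor C E f"
    and i: "fully_faithful C D i"
  have fob: "f ` ob C \<subseteq> ob E" and
    fhom: "\<And>c c'. c \<in> ob C \<Longrightarrow> c' \<in> ob C \<Longrightarrow> hom C c c' \<le> hom E (f c) (f c')"
    using f by (auto simp: qfunctor_def)
  have iob: "\<And>c. c \<in> ob C \<Longrightarrow> i c \<in> ob D" and
    ihom: "\<And>c c'. c \<in> ob C \<Longrightarrow> c' \<in> ob C \<Longrightarrow> hom D (i c) (i c') = hom C c c'"
    using i by (auto simp: fully_faithful_def qfunctor_def)
  \<comment> \<open>\<open>g\<close> is the left Kan extension of \<open>f\<close> along
    \<open>i\<close>: \<open>g d\<close> is the colimit of \<open>f\<close> with weight
    \<open>hom D (i c) d\<close>. Any function is admissible as a weight, so \<open>g\<close> can be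
    chosen on the whole type.\<close>
  obtain g where gob: "\<And>d. g d \<in> ob E" and
    ghom: "\<And>d e. e \<in> ob E \<Longrightarrow> hom E (g d) e = (INF c\<in>ob C. hom E (f c) e \<swarrow> hom D (i c) d)"
    using weighted_colimit_exists[OF E(1,3) fob, of "\<lambda>c. hom D (i c) d" for d] by metis
  have le_hom: "y \<le> hom E (g d) e \<longleftrightarrow> (\<forall>c\<in>ob C. y * hom D (i c) d \<le> hom E (f c) e)"
    if "e \<in> ob E" for y d e
    by (simp add: ghom[OF that] le_INF_iff swarrow_iff)
  \<comment> \<open>The component at \<open>c\<close> of the universal cocone, obtained from the
    identity of \<open>g d\<close>.\<close>
  have unit: "hom D (i c) d \<le> hom E (f c) (g d)" if "c \<in> ob C" for c d
    using le_hom[OF gob, of 1 d d] qcategory_id[OF E(1) gob] that by simp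
  have "qfunctor D E g"
    unfolding qfunctor_def
  proof (intro conjI ballI)
    fix d d' assume d: "d \<in> ob D" "d' \<in> ob D"
    show "hom D d d' \<le> hom E (g d) (g d')"
      \<comment> \<open>By \<open>le_hom\<close> the goal reduces to composition in \<open>D\<close>
        followed by \<open>unit\<close> at \<open>d'\<close>.\<close>
      using qcategory_comp[OF D iob d] unit by (auto simp: le_hom[OF gob] intro: order_trans)
  qed (use gob in auto)
  moreover have "f c = g (i c)" if c: "c \<in> ob C" for c
  proof -
    have fc: "f c \<in> ob E" using fob c by auto
    have "ob_le E (f c) (g (i c))"
      using unit[OF c, of "i c"] ihom[OF c c] qcategory_id[OF C c] by (simp add: ob_le_def)
    \<comment> \<open>Full faithfulness replaces the weight at \<open>i c\<close> by
      \<open>hom C c' c\<close>, so functoriality of \<open>f\<close> makes \<open>f c\<close> a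
      cocone. Skeletality then turns the isomorphism into equality.\<close>
    moreover have "ob_le E (g (i c)) (f c)"
      using fhom c by (simp add: ob_le_def le_hom[OF fc] ihom)
    ultimately show ?thesis
      using E(2) fc gob by (auto simp: skeletal_def isomorphic_def)
  qed
  ultimately show "\<exists>g. qfunctor D E g \<and> (\<forall>c\<in>ob C. f c = g (i c))" by blast
qed

section \<open>The Q-category of functions and the Yoneda embedding\<close>

definition fun_qcat :: "'a set \<Rightarrow> ('a \<Rightarrow> 'q, 'q::quantale) qcat"
  where "fun_qcat A = \<lparr>ob = UNIV, hom = (\<lambda>\<phi> \<psi>. INF a\<in>A. \<psi> a \<swarrow> \<phi> a)\<rparr>"

lemma ob_fun_qcat [simp]: "ob (fun_qcat A) = UNIV"
  by (simp add: fun_qcat_def)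

lemma le_hom_fun_qcat: "y \<le> hom (fun_qcat A) \<phi> \<psi> \<longleftrightarrow> (\<forall>a\<in>A. y * \<phi> a \<le> \<psi> a)"
  by (simp add: fun_qcat_def le_INF_iff swarrow_iff)

lemma qcategory_fun_qcat: "qcategory (fun_qcat A :: ('a \<Rightarrow> 'q, 'q::quantale) qcat)"
  unfolding qcategory_def
proof (intro conjI ballI)
  fix \<phi> \<psi> \<chi> :: "'a \<Rightarrow> 'q"
  let ?h = "hom (fun_qcat A :: ('a \<Rightarrow> 'q, 'q) qcat)"
  have "?h \<psi> \<chi> * ?h \<phi> \<psi> * \<phi> a \<le> \<chi> a" if "a \<in> A" for a
  proof -
    have "?h \<psi> \<chi> * (?h \<phi> \<psi> * \<phi> a) \<le> ?h \<psi> \<chi> * \<psi> a"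
      using le_hom_fun_qcat[of "?h \<phi> \<psi>" A \<phi> \<psi>] that by (simp add: mult_mono_left)
    also have "\<dots> \<le> \<chi> a"
      using le_hom_fun_qcat[of "?h \<psi> \<chi>" A \<psi> \<chi>] that by simp
    finally show ?thesis by (simp add: mult.assoc)
  qed
  then show "?h \<psi> \<chi> * ?h \<phi> \<psi> \<le> ?h \<phi> \<chi>" by (simp add: le_hom_fun_qcat)
qed (simp add: le_hom_fun_qcat)

text \<open>The value \<open>bot\<close> off \<open>ob C\<close> makes the images of isomorphic objects equal as functions on the
  whole type.\<close>

definition yoneda :: "('c, 'q::quantale) qcat \<Rightarrow> 'c \<Rightarrow> 'c \<Rightarrow> 'q"
  where "yoneda C c = (\<lambda>a. if a \<in> ob C then hom C a c else bot)"

lemma fully_faithful_yoneda: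
  assumes C: "qcategory C"
  shows "fully_faithful C (fun_qcat (ob C)) (yoneda C)"
proof -
  have "hom C c c' = hom (fun_qcat (ob C)) (yoneda C c) (yoneda C c')"
    if c: "c \<in> ob C" "c' \<in> ob C" for c c'
  proof (rule antisym)
    show "hom C c c' \<le> hom (fun_qcat (ob C)) (yoneda C c) (yoneda C c')"
      using c by (simp add: le_hom_fun_qcat yoneda_def qcategory_comp[OF C])
    let ?y = "hom (fun_qcat (ob C)) (yoneda C c) (yoneda C c')"
    \<comment> \<open>The Yoneda argument: evaluate the hom of functions at \<open>c\<close> itself
      and apply it to the identity of \<open>c\<close>.\<close>
    have "?y * 1 \<le> ?y * hom C c c" by (intro mult_mono_left qcategory_id[OF C] c)
    also have "\<dots> \<le> hom C c c'"
      using le_hom_fun_qcat[of ?y "ob C" "yoneda C c" "yoneda C c'"] c(1)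
      by (auto simp: yoneda_def)
    finally show "?y \<le> hom C c c'" by simp
  qed
  then show ?thesis by (simp add: fully_faithful_def qfunctor_def)
qed

lemma yoneda_cong_isomorphic:
  assumes "qcategory C" "c \<in> ob C" "c' \<in> ob C" "isomorphic C c c'"
  shows "yoneda C c = yoneda C c'"
  using assms
  by (auto simp: yoneda_def isomorphic_def fun_eq_iff intro: antisym hom_mono_right)

section \<open>Powers, copowers and suprema from a retraction of the Yoneda map\<close>

locale yoneda_retraction =
  fixes E :: "('e, 'q::quantale) qcat" and g :: "('e \<Rightarrow> 'q) \<Rightarrow> 'e"
  assumes qcat: "qcategory E"
    and g_functor: "qfunctor (fun_qcat (ob E)) E g"
    and retract: "c \<in> ob E \<Longrightarrow> g (yoneda E c) = c"
begin

lemma g_ob: "g \<phi> \<in> ob E"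
  using g_functor by (auto simp: qfunctor_def)

text \<open>The pointwise hypothesis bounds \<open>y\<close> by the hom from
  \<open>yoneda E c\<close> to \<open>\<phi>\<close>; the functor \<open>g\<close> carries this
  bound to \<open>E\<close> and returns \<open>yoneda E c\<close> to \<open>c\<close>. With the dual
  bound for homs out of \<open>g \<phi>\<close>, inequalities in \<open>E\<close> reduce to
  pointwise ones.\<close>

lemma le_hom_to_g:
  assumes "c \<in> ob E" "\<And>a. a \<in> ob E \<Longrightarrow> y * hom E a c \<le> \<phi> a"
  shows "y \<le> hom E c (g \<phi>)"
proof -
  have "y \<le> hom (fun_qcat (ob E)) (yoneda E c) \<phi>"
    using assms(2) by (simp add: le_hom_fun_qcat yoneda_def)
  also have "\<dots> \<le> hom E (g (yoneda E c)) (g \<phi>)"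
    using g_functor by (simp add: qfunctor_def)
  finally show ?thesis by (simp add: retract assms(1))
qed

lemma le_hom_from_g:
  assumes "c \<in> ob E" "\<And>a. a \<in> ob E \<Longrightarrow> y * \<phi> a \<le> hom E a c"
  shows "y \<le> hom E (g \<phi>) c"
proof -
  have "y \<le> hom (fun_qcat (ob E)) \<phi> (yoneda E c)"
    using assms(2) by (simp add: le_hom_fun_qcat yoneda_def)
  also have "\<dots> \<le> hom E (g \<phi>) (g (yoneda E c))"
    using g_functor by (simp add: qfunctor_def)
  finally show ?thesis by (simp add: retract assms(1))
qed

lemma skeletal: "skeletal E"
  unfolding skeletal_def by (metis retract yoneda_cong_isomorphic qcat)

text \<open>The function given to \<open>g\<close> is the copower of \<open>yoneda E c\<close> by
  \<open>x\<close> among functions, formed pointwise.\<close>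

lemma copower:
  assumes c: "c \<in> ob E"
  shows "is_copower E c x (g (\<lambda>a. x * hom E a c))" (is "is_copower E c x ?v")
  unfolding is_copower_def
proof (intro conjI ballI antisym g_ob)
  fix d assume d: "d \<in> ob E"
  \<comment> \<open>This is the unit of the copower; composing with it gives one inequality. The
    other comes from the pointwise bound below.\<close>
  have "x \<le> hom E c ?v" by (intro le_hom_to_g c) simp
  then show "hom E ?v d \<le> hom E c d \<swarrow> x"
    unfolding swarrow_iff by (intro qcategory_comp_le[OF qcat c g_ob d]) auto
  have "(hom E c d \<swarrow> x) * (x * hom E a c) \<le> hom E a d" if a: "a \<in> ob E" for a
    using qcategory_comp_le[OF qcat a c d, of "(hom E c d \<swarrow> x) * x" "hom E a c"]
    by (simp add: mult.assoc flip: swarrow_iff)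
  then show "hom E c d \<swarrow> x \<le> hom E ?v d" by (intro le_hom_from_g d)
qed

lemma power:
  assumes c: "c \<in> ob E"
  shows "is_power E c x (g (\<lambda>a. x \<searrow> hom E a c))" (is "is_power E c x ?v")
  unfolding is_power_def
proof (intro conjI ballI antisym g_ob)
  fix d assume d: "d \<in> ob E"
  have counit: "x * (x \<searrow> z) \<le> z" for z
    using searrow_iff[of "x \<searrow> z" x z] by simp
  \<comment> \<open>Dually to copowers, the counit of residuation gives the projection from
    \<open>?v\<close> to \<open>c\<close>, with which homs into \<open>?v\<close> are
    composed.\<close>
  have "x \<le> hom E ?v c" by (intro le_hom_from_g c counit)
  then show "hom E d ?v \<le> x \<searrow> hom E d c"
    unfolding searrow_iff by (intro qcategory_comp_le[OF qcat d g_ob c]) auto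
  have "(x \<searrow> hom E d c) * hom E a d \<le> x \<searrow> hom E a c" if a: "a \<in> ob E" for a
    using qcategory_comp_le[OF qcat a d c counit order_refl] by (simp add: searrow_iff mult.assoc)
  then show "x \<searrow> hom E d c \<le> hom E d ?v" by (intro le_hom_to_g d)
qed

text \<open>The pointwise supremum of the functions \<open>yoneda E s\<close> is sent by
  \<open>g\<close> to a supremum: each \<open>s\<close> lies below it, and an upper bound
  \<open>u\<close> dominates it because \<open>hom E a s \<le> hom E a u\<close>.\<close>

lemma lub:
  assumes S: "S \<subseteq> ob E"
  shows "is_lub E S (g (\<lambda>a. SUP s\<in>S. hom E a s))" (is "is_lub E S ?v")
  unfolding is_lub_def
proof (intro conjI ballI iffI g_ob)
  have upper: "ob_le E s ?v" if "s \<in> S" for s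
    using that S unfolding ob_le_def by (intro le_hom_to_g) (auto intro: SUP_upper)
  show "ob_le E s u" if "ob_le E ?v u" "u \<in> ob E" "s \<in> S" for s u
    using that S upper ob_le_trans[OF qcat _ g_ob] by blast
  show "ob_le E ?v u" if "\<forall>s\<in>S. ob_le E s u" "u \<in> ob E" for u
    unfolding ob_le_def
    using that S by (intro le_hom_from_g) (auto intro!: SUP_least hom_mono_right[OF qcat])
qed

lemma qcomplete: "qcomplete E"
  unfolding qcomplete_def order_complete_iff_lubs[OF qcat]
  using power copower lub by blast

end

text \<open>The retraction is an extension of the identity of \<open>E\<close> along the Yoneda map.
  The test categories are thus \<open>E\<close> and its function category, which explains the types
  \<open>'e\<close> and \<open>'e \<Rightarrow> 'q\<close>.\<close>

lemma yoneda_retraction_if_qinjective: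
  fixes E :: "('e, 'q::quantale) qcat"
  assumes E: "qcategory E" and inj: "qinjective TYPE('e) TYPE('e \<Rightarrow> 'q) E"
  obtains g where "yoneda_retraction E g"
proof -
  have "qfunctor E E (\<lambda>c. c)" by (simp add: qfunctor_def)
  then obtain g where "qfunctor (fun_qcat (ob E)) E g" "\<forall>c\<in>ob E. c = g (yoneda E c)"
    using inj E qcategory_fun_qcat fully_faithful_yoneda[OF E] unfolding qinjective_def by blast
  then show thesis using that E unfolding yoneda_retraction_def by metis
qed

(* Injectivity against test categories with objects in arbitrary types 'c and 'd follows from being
   skeletal and complete; conversely, injectivity against test categories with objects in the two
   types 'e and 'e => 'q already implies being skeletal and complete. *)
theorem theorem1p4:
  fixes E :: "('e, 'q::quantale) qcat"
  assumes "qcategory E"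
  shows "(skeletal E \<and> qcomplete E \<longleftrightarrow> qinjective TYPE('e) TYPE('e \<Rightarrow> 'q) E) \<and>
         (skeletal E \<and> qcomplete E \<longrightarrow> qinjective TYPE('c) TYPE('d) E)"
  by (metis assms qinjective_if_skeletal_qcomplete yoneda_retraction_if_qinjective
      yoneda_retraction.skeletal yoneda_retraction.qcomplete)

end
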